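(* Let $\zeta\in\mathbb{R}$ with $\zeta\notin(a,b)$, let $\tau,\sigma$ be constants, and let $(P_n)_{n\ge0}$ be an orthogonal polynomial sequence (OPS) with respect to $\mathcal{L}_{(y-\zeta)\omega}$ satisfying $$\mathcal{L}_{\omega}[P_n]=1,\qquad n=0,1,\ldots.$$ Then, for all $n\ge 0$ (as an identity in $x$), $$\int_a^b P_n(y)\,P_n\left[(y-\zeta)(\tau+\sigma x)+x\right]\omega(y)\,dy=P_n(x).$$
   Context: $(a,b)$ is an interval (possibly unbounded) of the real line. $\omega(y)$ is a non-negative integrable function on $(a,b)$ with $\int_a^b\omega(y)\,dy=1$, all of whose moments $\int_a^b y^k\omega(y)\,dy$ are finite (absolutely convergent). For a weight function $w$ on $(a,b)$, $\mathcal{L}_w$ denotes the linear functional $\mathcal{L}_w[f]=\int_a^b f(y)w(y)\,dy$; thus $\mathcal{L}_{(y-\zeta)\omega}[f]=\int_a^b f(y)(y-\zeta)\omega(y)\,dy$. A sequence of polynomials $(P_n)_{n\ge0}$ is an orthogonal polynomial sequence (OPS) with respect to (or for) $\mathcal{L}_w$ if (1) $P_n$ is a polynomial of degree $n$ for every $n$, and (2) $\mathcal{L}_w[P_nP_m]=h_n\delta_{n,m}$ for $n,m=0,1,\ldots$, where $h_n\neq0$ for all $n$ and $\delta_{n,m}$ is Kronecker's delta. $P_n[\,\cdot\,]$ denotes evaluation of the polynomial $P_n$. *)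

theory Defs
  imports "HOL-Analysis.Analysis" "HOL-Computational_Algebra.Polynomial"
begin

text \<open>
  The interval is \<open>einterval a b\<close> with extended real endpoints, so it may be unbounded, and
  integrals are taken with respect to \<open>lebesgue\<close> rather than \<open>lborel\<close>, so that
  weights need not be Borel measurable. The scalar type \<open>'a\<close> can be instantiated with
  both \<open>real\<close> and \<open>complex\<close>.
\<close>

definition weight_functional ::
    "ereal \<Rightarrow> ereal \<Rightarrow> (real \<Rightarrow> real) \<Rightarrow>
      (real \<Rightarrow> 'a::{real_normed_field, banach, second_countable_topology}) \<Rightarrow> 'a" where
  "weight_functional a b w f = (LINT y:einterval a b|lebesgue. f y * of_real (w y))"

text \<open>
  \<open>degree (0 :: 'a poly) = 0\<close>, but \<open>P 0 = 0\<close> is excluded by \<open>h 0 \<noteq> 0\<close>.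
\<close>

definition OPS ::
    "((real \<Rightarrow> 'a::real_normed_field) \<Rightarrow> 'a) \<Rightarrow> (nat \<Rightarrow> 'a poly) \<Rightarrow> bool" where
  "OPS L P \<longleftrightarrow>
     (\<forall>n. degree (P n) = n) \<and>
     (\<exists>h. (\<forall>n. h n \<noteq> 0) \<and>
          (\<forall>n m. L (\<lambda>y. poly (P n) (of_real y) * poly (P m) (of_real y)) =
                   (if n = m then h n else 0)))"

end

theory Submission
  imports Defs
begin

text \<open>
  As a polynomial in \<open>y\<close>, the second factor has degree at most \<open>n\<close> and takes the value
  \<open>poly (P n) x\<close> at \<open>y = \<zeta>\<close>, so it equals \<open>poly (P n) x + (y - \<zeta>) r(y)\<close> with
  \<open>r\<close> of degree less than \<open>n\<close> (or zero). The constant contributes \<open>poly (P n) x\<close> by the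
  normalisation, and the remainder is orthogonal to \<open>P n\<close> for the weight \<open>(y - \<zeta>) \<omega>\<close>.
\<close>

text \<open>A polynomial is a finite combination of powers, so integrability reduces to the real
  moments, carried into \<open>'a\<close> by \<open>of_real\<close>.\<close>

lemma set_integrable_poly_of_real:
  fixes p :: "'a::{real_normed_field, banach, second_countable_topology} poly"
    and w :: "real \<Rightarrow> real"
  assumes "\<And>k. set_integrable M A (\<lambda>y. y ^ k * w y)"
  shows "set_integrable M A (\<lambda>y. poly p (of_real y) * of_real (w y))"
proof -
  have "integrable M (\<lambda>y. of_real (indicator A y *\<^sub>R (y ^ k * w y)) :: 'a)" for k
    using assms[of k] unfolding set_integrable_def by (rule integrable_of_real)
  then have "integrable M (\<lambda>y. \<Sum>k\<le>degree p. coeff p k *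
      (of_real (indicator A y *\<^sub>R (y ^ k * w y)) :: 'a))"
    by (intro Bochner_Integration.integrable_sum integrable_mult_right)
  moreover have "(\<Sum>k\<le>degree p. coeff p k * (of_real (indicator A y *\<^sub>R (y ^ k * w y)) :: 'a)) =
      indicator A y *\<^sub>R (poly p (of_real y) * of_real (w y))" for y
    by (simp add: poly_altdef sum_distrib_left sum_distrib_right scaleR_conv_of_real mult_ac)
  ultimately show ?thesis
    unfolding set_integrable_def by simp
qed

text \<open>Makes the orthogonality lemma applicable to the weight (y - \<zeta>) \<omega>, although
  only the moments of \<omega> are assumed finite.\<close>

lemma moments_mult_linear:
  fixes w :: "real \<Rightarrow> real"
  assumes "\<And>k. set_integrable M A (\<lambda>y. y ^ k * w y)"
  shows "set_integrable M A (\<lambda>y. y ^ k * ((y - c) * w y))"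
proof -
  have "set_integrable M A (\<lambda>y. y ^ Suc k * w y - c * (y ^ k * w y))"
    by (intro set_integral_diff(1) set_integrable_mult_right assms)
  moreover have "y ^ Suc k * w y - c * (y ^ k * w y) = y ^ k * ((y - c) * w y)" for y
    by (simp add: algebra_simps)
  ultimately show ?thesis
    by simp
qed

lemma weight_functional_poly_add:
  fixes p q :: "'a::{real_normed_field, banach, second_countable_topology} poly"
  assumes "\<And>k. set_integrable lebesgue (einterval a b) (\<lambda>y. y ^ k * w y)"
  shows "weight_functional a b w (\<lambda>y. poly (p + q) (of_real y)) =
    weight_functional a b w (\<lambda>y. poly p (of_real y)) +
    weight_functional a b w (\<lambda>y. poly q (of_real y))"
  unfolding weight_functional_def
  using set_integral_add(2)[OF set_integrable_poly_of_real[OF assms, of p]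
      set_integrable_poly_of_real[OF assms, of q]]
  by (simp add: distrib_right)

lemma weight_functional_poly_smult:
  fixes p :: "'a::{real_normed_field, banach, second_countable_topology} poly"
  shows "weight_functional a b w (\<lambda>y. poly (smult c p) (of_real y)) =
    c * weight_functional a b w (\<lambda>y. poly p (of_real y))"
  by (simp add: weight_functional_def mult.assoc)

text \<open>Subtracting a multiple of \<open>P m\<close> removes the coefficient of order
  \<open>m\<close>, so induction on \<open>m\<close> reduces \<open>q\<close> to zero. Bounding
  coefficients instead of writing \<open>degree q < m\<close> lets \<open>m = 0\<close> mean
  \<open>q = 0\<close>.\<close>

lemma OPS_orthogonal_lower_degree:
  fixes P :: "nat \<Rightarrow> 'a::{real_normed_field, banach, second_countable_topology} poly"
  assumes moments: "\<And>k. set_integrable lebesgue (einterval a b) (\<lambda>y. y ^ k * w y)"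
    and ops: "OPS (weight_functional a b w) P"
    and "m \<le> n" and "\<And>i. m \<le> i \<Longrightarrow> coeff q i = 0"
  shows "weight_functional a b w (\<lambda>y. poly (P n * q) (of_real y)) = 0"
  using assms(3,4)
proof (induction m arbitrary: q)
  case 0
  then have "q = 0"
    by (simp add: poly_eq_iff)
  then show ?case
    by (simp add: weight_functional_def set_lebesgue_integral_def)
next
  case (Suc m)
  obtain h where deg: "\<And>k. degree (P k) = k" and h: "\<And>k. h k \<noteq> 0"
    and orth: "\<And>k l. weight_functional a b w
        (\<lambda>y. poly (P k) (of_real y) * poly (P l) (of_real y)) = (if k = l then h k else 0)"
    using ops unfolding OPS_def by metis
  \<comment> \<open>For \<open>m = 0\<close> the degree condition would allow the zero polynomial;
    \<open>h m \<noteq> 0\<close> rules it out.\<close>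
  have "P m \<noteq> 0"
  proof
    assume "P m = 0"
    with orth[of m m] h[of m] show False
      by (simp add: weight_functional_def set_lebesgue_integral_def)
  qed
  then have lc: "coeff (P m) m \<noteq> 0"
    by (metis deg leading_coeff_0_iff)
  define c where "c = coeff q m / coeff (P m) m"
  define r where "r = q - smult c (P m)"
  have "coeff r i = 0" if "m \<le> i" for i
  proof (cases "i = m")
    case True
    then show ?thesis
      using lc by (simp add: r_def c_def)
  next
    case False
    with that Suc.prems(2)[of i] show ?thesis
      by (simp add: r_def coeff_eq_0 deg)
  qed
  then have r0: "weight_functional a b w (\<lambda>y. poly (P n * r) (of_real y)) = 0"
    using Suc by simp
  have split: "P n * q = P n * r + smult c (P n * P m)"
    by (simp add: r_def algebra_simps)
  \<comment> \<open>Here \<open>Suc m \<le> n\<close>, hence \<open>n \<noteq> m\<close> and the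
    pair is off the diagonal.\<close>
  have Pm0: "weight_functional a b w (\<lambda>y. poly (P n * P m) (of_real y)) = 0"
    using orth[of n m] Suc.prems(1) by simp
  show ?case
    unfolding split weight_functional_poly_add[OF moments] weight_functional_poly_smult r0 Pm0
    by simp
qed

text \<open>Division by a monic linear factor lowers a positive degree by one, and a constant has
  quotient 0. The coefficient form covers both cases, including \<open>n = 0\<close>.\<close>

lemma coeff_synthetic_div_eq_0:
  assumes "degree p \<le> n" "n \<le> i"
  shows "coeff (synthetic_div p c) i = 0"
proof (cases "degree p = 0")
  case True
  then show ?thesis
    by (simp add: synthetic_div_eq_0_iff[THEN iffD2])
next
  case False
  then show ?thesis
    using assms by (intro coeff_eq_0) (simp add: degree_synthetic_div)
qed

theorem theorem5:
  fixes a b :: ereal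
    and \<omega> :: "real \<Rightarrow> real"
    and \<zeta> :: real
    and \<tau> \<sigma> :: "'a::{real_normed_field, banach, second_countable_topology}"
    and P :: "nat \<Rightarrow> 'a poly"
  assumes "a < b"
    and "\<And>y. y \<in> einterval a b \<Longrightarrow> 0 \<le> \<omega> y"
    and "set_integrable lebesgue (einterval a b) \<omega>"
    and "(LINT y:einterval a b|lebesgue. \<omega> y) = 1"
    and "\<And>k::nat. set_integrable lebesgue (einterval a b) (\<lambda>y. y ^ k * \<omega> y)"
    and "\<zeta> \<notin> einterval a b"
    and "OPS (weight_functional a b (\<lambda>y. (y - \<zeta>) * \<omega> y)) P"
    and "\<And>n. weight_functional a b \<omega> (\<lambda>y. poly (P n) (of_real y)) = 1"
  shows "\<forall>n. \<forall>x::'a.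
    (LINT y:einterval a b|lebesgue.
       poly (P n) (of_real y)
       * poly (P n) ((of_real y - of_real \<zeta>) * (\<tau> + \<sigma> * x) + x)
       * of_real (\<omega> y)) = poly (P n) x"
proof (intro allI)
  fix n and x :: 'a
  note moments = assms(5)
  define t where "t = \<tau> + \<sigma> * x"
  define z where "z = (of_real \<zeta> :: 'a)"
  define q where "q = P n \<circ>\<^sub>p [:x - z * t, t:]"
  define r where "r = synthetic_div q z"
  have poly_q: "poly q y = poly (P n) ((y - z) * t + x)" for y
    by (simp add: q_def poly_pcompose algebra_simps)
  \<comment> \<open>Only an inequality is available: \<open>t\<close> may vanish for some
    \<open>x\<close>, and then \<open>q\<close> is constant.\<close>
  have "degree q \<le> degree (P n) * degree [:x - z * t, t:]"
    unfolding q_def by (rule degree_pcompose_le)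
  also have "\<dots> \<le> degree (P n) * 1"
    by (intro mult_left_mono) auto
  also have "\<dots> = n"
    using assms(7) by (simp add: OPS_def)
  finally have deg_q: "degree q \<le> n" .
  \<comment> \<open>The remainder is \<open>poly q z\<close>, and at \<open>z\<close> the inner
    linear polynomial takes the value \<open>x\<close>.\<close>
  have "q = [:- z, 1:] * r + [:poly (P n) x:]"
    using synthetic_div_correct'[of z q] by (simp add: r_def poly_q)
  then have split: "P n * q = [:- z, 1:] * (P n * r) + smult (poly (P n) x) (P n)"
    by (simp only:) (simp add: algebra_simps)
  \<comment> \<open>The factor y - \<zeta> moves from the integrand into the weight, which is the
    one that \<open>P\<close> is orthogonal for.\<close>
  have "weight_functional a b \<omega> (\<lambda>y. poly ([:- z, 1:] * (P n * r)) (of_real y)) =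
      weight_functional a b (\<lambda>y. (y - \<zeta>) * \<omega> y) (\<lambda>y. poly (P n * r) (of_real y))"
    by (simp add: weight_functional_def z_def algebra_simps)
  also have "\<dots> = 0"
    by (rule OPS_orthogonal_lower_degree[OF moments_mult_linear[OF moments] assms(7) order_refl])
      (simp add: r_def coeff_synthetic_div_eq_0[OF deg_q])
  finally have "weight_functional a b \<omega> (\<lambda>y. poly (P n * q) (of_real y)) = poly (P n) x"
    unfolding split weight_functional_poly_add[OF moments] weight_functional_poly_smult assms(8)
    by simp
  then show "(LINT y:einterval a b|lebesgue.
       poly (P n) (of_real y)
       * poly (P n) ((of_real y - of_real \<zeta>) * (\<tau> + \<sigma> * x) + x)
       * of_real (\<omega> y)) = poly (P n) x"
    by (simp add: weight_functional_def poly_q t_def z_def)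
qed

end
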